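(* Let $A$ be a commutative unital algebra over a commutative ring $\mathbb{K}$ and $\Delta\in A$. Then $\Delta$ is well-tempered if and only if $\Delta$ is invertible in $A$.
   Context: Algebras over $\mathbb{K}$ are associative and assumed to be free as $\mathbb{K}$-modules. Homotope: for a unital $\mathbb{K}$-algebra $A$ and $\Delta\in A$, $B^+=A_\Delta$ is the algebra with underlying module $A$ and multiplication $a\cdot_\Delta b=a\Delta b$; $B=\widehat{A}_\Delta=\mathbb{K}\cdot 1\oplus B^+$ is obtained by adjoining a unit, so $B^+$ is a two-sided ideal of $B$. Well-tempered: $\Delta\in A$ is well-tempered if the multiplication map $B^+\otimes_{\mathbb{K}}B^+\to B^+$ is surjective (equivalently $A\Delta A=A$, the two-sided ideal generated by $\Delta$ being all of $A$) and $B^+$ is projective both as a left and as a right $B$-module. *)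

theory Defs
  imports "HOL.Hull" "HOL-Algebra.Module" "HOL-Algebra.AbelCoset" "HOL-Algebra.Ideal"
begin

section \<open>Modules over a possibly non-commutative ring\<close>

text \<open>
  The locale \<^locale>\<open>module\<close> of the library asks for a commutative ring of scalars, so
  one-sided modules are introduced here. A right module over a ring is a left module over the
  opposite ring.
\<close>

locale left_module = R?: ring R + M?: abelian_group M for R and M (structure) +
  assumes lsmult_closed [simp, intro]:
      "\<lbrakk>a \<in> carrier R; x \<in> carrier M\<rbrakk> \<Longrightarrow> a \<odot>\<^bsub>M\<^esub> x \<in> carrier M"
    and lsmult_l_distr:
      "\<lbrakk>a \<in> carrier R; b \<in> carrier R; x \<in> carrier M\<rbrakk> \<Longrightarrow>
        (a \<oplus>\<^bsub>R\<^esub> b) \<odot>\<^bsub>M\<^esub> x = a \<odot>\<^bsub>M\<^esub> x \<oplus>\<^bsub>M\<^esub> b \<odot>\<^bsub>M\<^esub> x"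
    and lsmult_r_distr:
      "\<lbrakk>a \<in> carrier R; x \<in> carrier M; y \<in> carrier M\<rbrakk> \<Longrightarrow>
        a \<odot>\<^bsub>M\<^esub> (x \<oplus>\<^bsub>M\<^esub> y) = a \<odot>\<^bsub>M\<^esub> x \<oplus>\<^bsub>M\<^esub> a \<odot>\<^bsub>M\<^esub> y"
    and lsmult_assoc:
      "\<lbrakk>a \<in> carrier R; b \<in> carrier R; x \<in> carrier M\<rbrakk> \<Longrightarrow>
        (a \<otimes>\<^bsub>R\<^esub> b) \<odot>\<^bsub>M\<^esub> x = a \<odot>\<^bsub>M\<^esub> (b \<odot>\<^bsub>M\<^esub> x)"
    and lsmult_one [simp]: "x \<in> carrier M \<Longrightarrow> \<one>\<^bsub>R\<^esub> \<odot>\<^bsub>M\<^esub> x = x"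

definition opposite_ring :: "('r, 's) ring_scheme \<Rightarrow> ('r, 's) ring_scheme"
  where "opposite_ring R = R\<lparr>mult := \<lambda>x y. y \<otimes>\<^bsub>R\<^esub> x\<rparr>"

definition left_module_hom ::
    "('r, 's) ring_scheme \<Rightarrow> ('r, 'm, 't) module_scheme \<Rightarrow> ('r, 'n, 'u) module_scheme \<Rightarrow> ('m \<Rightarrow> 'n) set"
  where "left_module_hom R M N =
    {f \<in> carrier M \<rightarrow> carrier N.
       (\<forall>x\<in>carrier M. \<forall>y\<in>carrier M. f (x \<oplus>\<^bsub>M\<^esub> y) = f x \<oplus>\<^bsub>N\<^esub> f y) \<and>
       (\<forall>a\<in>carrier R. \<forall>x\<in>carrier M. f (a \<odot>\<^bsub>M\<^esub> x) = a \<odot>\<^bsub>N\<^esub> f x)}"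

definition lifts_along ::
    "('r, 's) ring_scheme \<Rightarrow> ('r, 'p, 't) module_scheme \<Rightarrow>
     ('r, 'm, 'u) module_scheme \<Rightarrow> ('r, 'n, 'v) module_scheme \<Rightarrow> bool"
  where "lifts_along R P M N \<longleftrightarrow>
    (\<forall>g\<in>left_module_hom R M N. \<forall>f\<in>left_module_hom R P N. g ` carrier M = carrier N \<longrightarrow>
       (\<exists>h\<in>left_module_hom R P M. \<forall>x\<in>carrier P. g (h x) = f x))"

text \<open>
  Projectivity is the lifting property along all surjections \<open>M \<rightarrow> N\<close>. A definition cannot
  quantify over types, so the elements of \<open>M\<close> are taken from \<^typ>\<open>'p \<Rightarrow> 'r\<close> and those of \<open>N\<close>
  from \<^typ>\<open>'p\<close>. This is no restriction: these types accommodate the canonical surjection from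
  the free module on the set \<open>P\<close> onto \<open>P\<close>, and \<open>projective_lifts_along\<close> below derives the
  lifting property for modules over arbitrary types.
\<close>

definition projective_module :: "('r, 's) ring_scheme \<Rightarrow> ('r, 'p) module \<Rightarrow> bool"
  where "projective_module R P \<longleftrightarrow> left_module R P \<and>
    (\<forall>(M :: ('r, 'p \<Rightarrow> 'r) module) (N :: ('r, 'p) module).
       left_module R M \<longrightarrow> left_module R N \<longrightarrow> lifts_along R P M N)"

text \<open>
  The free module \<open>R\<^sup>(\<^sup>I\<^sup>)\<close> of finitely supported functions on \<open>I\<close>. The fields for ring
  multiplication and its unit are part of the record but play no role for modules.
\<close>

definition free_module :: "('r, 's) ring_scheme \<Rightarrow> 'i set \<Rightarrow> ('r, 'i \<Rightarrow> 'r) module"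
  where "free_module R I =
    \<lparr>carrier = {c. (\<forall>i\<in>I. c i \<in> carrier R) \<and> (\<forall>i. i \<notin> I \<longrightarrow> c i = \<zero>\<^bsub>R\<^esub>) \<and> finite {i. c i \<noteq> \<zero>\<^bsub>R\<^esub>}},
     mult = undefined, one = undefined,
     zero = (\<lambda>i. \<zero>\<^bsub>R\<^esub>), add = (\<lambda>c d i. c i \<oplus>\<^bsub>R\<^esub> d i),
     smult = (\<lambda>a c i. a \<otimes>\<^bsub>R\<^esub> c i)\<rparr>"

definition free_delta :: "('r, 's) ring_scheme \<Rightarrow> 'i \<Rightarrow> 'i \<Rightarrow> 'r"
  where "free_delta R i = (\<lambda>j. if j = i then \<one>\<^bsub>R\<^esub> else \<zero>\<^bsub>R\<^esub>)"

definition free_lift ::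
    "('r, 's) ring_scheme \<Rightarrow> ('r, 'm, 't) module_scheme \<Rightarrow> ('i \<Rightarrow> 'm) \<Rightarrow> ('i \<Rightarrow> 'r) \<Rightarrow> 'm"
  where "free_lift R M \<phi> c = (\<Oplus>\<^bsub>M\<^esub>i\<in>{i. c i \<noteq> \<zero>\<^bsub>R\<^esub>}. c i \<odot>\<^bsub>M\<^esub> \<phi> i)"

definition is_free_module :: "('r, 's) ring_scheme \<Rightarrow> ('r, 'm, 't) module_scheme \<Rightarrow> bool"
  where "is_free_module R M \<longleftrightarrow>
    (\<exists>X\<subseteq>carrier M. bij_betw (free_lift R M id) (carrier (free_module R X)) (carrier M))"


subsection \<open>Basic properties\<close>

lemma left_moduleI:
  fixes R (structure) and M (structure)
  assumes "ring R" "abelian_group M"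
    and "\<And>a x. \<lbrakk>a \<in> carrier R; x \<in> carrier M\<rbrakk> \<Longrightarrow> a \<odot>\<^bsub>M\<^esub> x \<in> carrier M"
    and "\<And>a b x. \<lbrakk>a \<in> carrier R; b \<in> carrier R; x \<in> carrier M\<rbrakk> \<Longrightarrow>
      (a \<oplus>\<^bsub>R\<^esub> b) \<odot>\<^bsub>M\<^esub> x = a \<odot>\<^bsub>M\<^esub> x \<oplus>\<^bsub>M\<^esub> b \<odot>\<^bsub>M\<^esub> x"
    and "\<And>a x y. \<lbrakk>a \<in> carrier R; x \<in> carrier M; y \<in> carrier M\<rbrakk> \<Longrightarrow>
      a \<odot>\<^bsub>M\<^esub> (x \<oplus>\<^bsub>M\<^esub> y) = a \<odot>\<^bsub>M\<^esub> x \<oplus>\<^bsub>M\<^esub> a \<odot>\<^bsub>M\<^esub> y"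
    and "\<And>a b x. \<lbrakk>a \<in> carrier R; b \<in> carrier R; x \<in> carrier M\<rbrakk> \<Longrightarrow>
      (a \<otimes>\<^bsub>R\<^esub> b) \<odot>\<^bsub>M\<^esub> x = a \<odot>\<^bsub>M\<^esub> (b \<odot>\<^bsub>M\<^esub> x)"
    and "\<And>x. x \<in> carrier M \<Longrightarrow> \<one>\<^bsub>R\<^esub> \<odot>\<^bsub>M\<^esub> x = x"
  shows "left_module R M"
  using assms by (simp add: left_module_def left_module_axioms_def)

lemma (in module) left_module: "left_module R M"
  by (intro left_moduleI R.ring_axioms M.abelian_group_axioms)
     (auto simp: smult_l_distr smult_r_distr smult_assoc1)

lemma ring_opposite_ring:
  assumes "ring R"
  shows "ring (opposite_ring R)"
proof -
  interpret ring R by fact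
  show ?thesis
  proof (rule ringI)
    show "abelian_group (opposite_ring R)"
    proof (rule abelian_groupI)
      show "\<exists>y\<in>carrier (opposite_ring R). y \<oplus>\<^bsub>opposite_ring R\<^esub> x = \<zero>\<^bsub>opposite_ring R\<^esub>"
        if "x \<in> carrier (opposite_ring R)" for x
        using that by (intro bexI[of _ "\<ominus>\<^bsub>R\<^esub> x"]) (auto simp: opposite_ring_def l_neg)
    qed (auto simp: opposite_ring_def a_ac)
    show "monoid (opposite_ring R)"
      by (rule monoidI) (auto simp: opposite_ring_def m_assoc)
  qed (auto simp: opposite_ring_def l_distr r_distr)
qed

context left_module begin

lemma lsmult_l_null [simp]: "x \<in> carrier M \<Longrightarrow> \<zero>\<^bsub>R\<^esub> \<odot>\<^bsub>M\<^esub> x = \<zero>\<^bsub>M\<^esub>"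
  using lsmult_l_distr[of "\<zero>\<^bsub>R\<^esub>" "\<zero>\<^bsub>R\<^esub>" x] by (simp add: M.add.r_cancel_one')

lemma lsmult_r_null [simp]: "a \<in> carrier R \<Longrightarrow> a \<odot>\<^bsub>M\<^esub> \<zero>\<^bsub>M\<^esub> = \<zero>\<^bsub>M\<^esub>"
  using lsmult_r_distr[of a "\<zero>\<^bsub>M\<^esub>" "\<zero>\<^bsub>M\<^esub>"] by (simp add: M.add.r_cancel_one')

lemma lsmult_finsum:
  assumes "finite S" "a \<in> carrier R" "h \<in> S \<rightarrow> carrier M"
  shows "a \<odot>\<^bsub>M\<^esub> finsum M h S = finsum M (\<lambda>i. a \<odot>\<^bsub>M\<^esub> h i) S"
  using assms
proof (induction S)
  case (insert i S)
  have "(\<lambda>i. a \<odot>\<^bsub>M\<^esub> h i) \<in> S \<rightarrow> carrier M" using insert by auto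
  with insert show ?case by (simp add: M.finsum_insert lsmult_r_distr Pi_iff)
qed simp

end

lemma left_module_hom_zero:
  assumes "left_module R M" "left_module R N" "f \<in> left_module_hom R M N"
  shows "f \<zero>\<^bsub>M\<^esub> = \<zero>\<^bsub>N\<^esub>"
proof -
  interpret M: left_module R M by fact
  interpret N: left_module R N by fact
  have "f (\<zero>\<^bsub>R\<^esub> \<odot>\<^bsub>M\<^esub> \<zero>\<^bsub>M\<^esub>) = \<zero>\<^bsub>R\<^esub> \<odot>\<^bsub>N\<^esub> f \<zero>\<^bsub>M\<^esub>" "f \<zero>\<^bsub>M\<^esub> \<in> carrier N"
    using assms(3) by (auto simp: left_module_hom_def simp del: M.lsmult_l_null M.lsmult_r_null)
  then show ?thesis by simp
qed

lemma left_module_hom_finsum: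
  assumes M: "left_module R M" and N: "left_module R N" and f: "f \<in> left_module_hom R M N"
    and "finite S" "h \<in> S \<rightarrow> carrier M"
  shows "f (finsum M h S) = finsum N (\<lambda>i. f (h i)) S"
proof -
  interpret M: left_module R M by fact
  interpret N: left_module R N by fact
  have fc: "f \<in> carrier M \<rightarrow> carrier N"
    and fa: "\<And>x y. \<lbrakk>x \<in> carrier M; y \<in> carrier M\<rbrakk> \<Longrightarrow> f (x \<oplus>\<^bsub>M\<^esub> y) = f x \<oplus>\<^bsub>N\<^esub> f y"
    using f by (auto simp: left_module_hom_def)
  show ?thesis using assms(4,5)
  proof (induction S)
    case empty
    then show ?case using left_module_hom_zero[OF M N f] by simp
  next
    case (insert i S)
    have "(\<lambda>i. f (h i)) \<in> S \<rightarrow> carrier N" "finsum M h S \<in> carrier M"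
      using insert fc by (auto intro!: M.finsum_closed)
    with insert fc show ?case by (simp add: M.finsum_insert N.finsum_insert fa Pi_iff)
  qed
qed

lemma left_module_free_module:
  assumes "ring R"
  shows "left_module R (free_module R I)"
proof -
  interpret ring R by fact
  have fin: "finite {i. c i \<oplus>\<^bsub>R\<^esub> d i \<noteq> \<zero>\<^bsub>R\<^esub>}"
    if "finite {i. c i \<noteq> \<zero>\<^bsub>R\<^esub>}" "finite {i. d i \<noteq> \<zero>\<^bsub>R\<^esub>}" for c d :: "'c \<Rightarrow> 'a"
    by (rule finite_subset[OF _ finite_UnI[OF that]]) auto
  have fin': "finite {i. a \<otimes>\<^bsub>R\<^esub> c i \<noteq> \<zero>\<^bsub>R\<^esub>}"
    if "finite {i. c i \<noteq> \<zero>\<^bsub>R\<^esub>}" "a \<in> carrier R" for a and c :: "'c \<Rightarrow> 'a"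
    by (rule finite_subset[OF _ that(1)]) (use that in auto)
  have car: "c i \<in> carrier R" if "c \<in> carrier (free_module R I)" for c i
    using that by (cases "i \<in> I") (auto simp: free_module_def)
  show ?thesis
  proof (rule left_moduleI)
    show "abelian_group (free_module R I)"
    proof (rule abelian_groupI)
      fix c assume c: "c \<in> carrier (free_module R I)"
      have "finite {i. \<ominus>\<^bsub>R\<^esub> c i \<noteq> \<zero>\<^bsub>R\<^esub>}"
        by (rule finite_subset[of _ "{i. c i \<noteq> \<zero>\<^bsub>R\<^esub>}"]) (use c in \<open>auto simp: free_module_def\<close>)
      then show "\<exists>d\<in>carrier (free_module R I).
          d \<oplus>\<^bsub>free_module R I\<^esub> c = \<zero>\<^bsub>free_module R I\<^esub>"
        using c car[OF c]
        by (intro bexI[of _ "\<lambda>i. \<ominus>\<^bsub>R\<^esub> c i"]) (auto simp: free_module_def l_neg fun_eq_iff)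
    next
      fix c d e assume cde: "c \<in> carrier (free_module R I)" "d \<in> carrier (free_module R I)"
        "e \<in> carrier (free_module R I)"
      show "c \<oplus>\<^bsub>free_module R I\<^esub> d \<oplus>\<^bsub>free_module R I\<^esub> e =
        c \<oplus>\<^bsub>free_module R I\<^esub> (d \<oplus>\<^bsub>free_module R I\<^esub> e)"
        using cde[THEN car] by (simp add: free_module_def a_assoc)
    next
      fix c d assume cd: "c \<in> carrier (free_module R I)" "d \<in> carrier (free_module R I)"
      show "c \<oplus>\<^bsub>free_module R I\<^esub> d = d \<oplus>\<^bsub>free_module R I\<^esub> c"
        using cd[THEN car] by (simp add: free_module_def a_comm)
    next
      fix c assume c: "c \<in> carrier (free_module R I)"
      show "\<zero>\<^bsub>free_module R I\<^esub> \<oplus>\<^bsub>free_module R I\<^esub> c = c"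
        using car[OF c] by (simp add: free_module_def)
    qed (auto simp: free_module_def intro!: fin)
  next
    fix a x assume "a \<in> carrier R" "x \<in> carrier (free_module R I)"
    then show "a \<odot>\<^bsub>free_module R I\<^esub> x \<in> carrier (free_module R I)"
      by (auto simp: free_module_def intro!: fin')
  next
    fix a b x assume "a \<in> carrier R" "b \<in> carrier R" "x \<in> carrier (free_module R I)"
    then show "(a \<oplus>\<^bsub>R\<^esub> b) \<odot>\<^bsub>free_module R I\<^esub> x =
       a \<odot>\<^bsub>free_module R I\<^esub> x \<oplus>\<^bsub>free_module R I\<^esub> b \<odot>\<^bsub>free_module R I\<^esub> x"
      using car[of x] by (simp add: free_module_def l_distr)
  next
    fix a x y assume "a \<in> carrier R" "x \<in> carrier (free_module R I)" "y \<in> carrier (free_module R I)"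
    then show "a \<odot>\<^bsub>free_module R I\<^esub> (x \<oplus>\<^bsub>free_module R I\<^esub> y) =
       a \<odot>\<^bsub>free_module R I\<^esub> x \<oplus>\<^bsub>free_module R I\<^esub> a \<odot>\<^bsub>free_module R I\<^esub> y"
      using car[of x] car[of y] by (simp add: free_module_def r_distr)
  next
    fix a b x assume "a \<in> carrier R" "b \<in> carrier R" "x \<in> carrier (free_module R I)"
    then show "(a \<otimes>\<^bsub>R\<^esub> b) \<odot>\<^bsub>free_module R I\<^esub> x =
       a \<odot>\<^bsub>free_module R I\<^esub> (b \<odot>\<^bsub>free_module R I\<^esub> x)"
      using car[of x] by (simp add: free_module_def m_assoc)
  next
    fix x assume "x \<in> carrier (free_module R I)"
    then show "\<one>\<^bsub>R\<^esub> \<odot>\<^bsub>free_module R I\<^esub> x = x"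
      using car[of x] by (simp add: free_module_def)
  qed (rule ring_axioms)
qed

lemma module_free_module:
  assumes "cring K"
  shows "module K (free_module K I)"
proof -
  interpret cring K by fact
  interpret left_module K "free_module K I" by (rule left_module_free_module) (rule ring_axioms)
  show ?thesis
    by (intro moduleI is_cring M.abelian_group_axioms)
       (auto simp: lsmult_l_distr lsmult_r_distr lsmult_assoc)
qed

lemma free_delta_closed:
  assumes "ring R" "i \<in> I"
  shows "free_delta R i \<in> carrier (free_module R I)"
proof -
  interpret ring R by fact
  have "finite {j. free_delta R i j \<noteq> \<zero>\<^bsub>R\<^esub>}"
    by (rule finite_subset[of _ "{i}"]) (auto simp: free_delta_def)
  then show ?thesis
    using assms(2) by (auto simp: free_module_def free_delta_def)
qed

context left_module begin

lemma free_lift_eq: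
  assumes c: "c \<in> carrier (free_module R I)" and \<phi>: "\<phi> \<in> I \<rightarrow> carrier M"
    and S: "finite S" "{i. c i \<noteq> \<zero>\<^bsub>R\<^esub>} \<subseteq> S" "S \<subseteq> I"
  shows "free_lift R M \<phi> c = finsum M (\<lambda>i. c i \<odot>\<^bsub>M\<^esub> \<phi> i) S"
  unfolding free_lift_def
proof (rule M.add.finprod_mono_neutral_cong_left)
  show "(\<lambda>i. c i \<odot>\<^bsub>M\<^esub> \<phi> i) \<in> S \<rightarrow> carrier M"
    using c \<phi> S by (auto simp: free_module_def Pi_iff subset_iff)
  show "c i \<odot>\<^bsub>M\<^esub> \<phi> i = \<zero>\<^bsub>M\<^esub>" if "i \<in> S - {i. c i \<noteq> \<zero>\<^bsub>R\<^esub>}" for i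
    using that \<phi> S by (auto simp: Pi_iff subset_iff)
qed (use S in auto)

lemma free_lift_hom:
  assumes \<phi>: "\<phi> \<in> I \<rightarrow> carrier M"
  shows "free_lift R M \<phi> \<in> left_module_hom R (free_module R I) M"
  unfolding left_module_hom_def
proof (intro CollectI conjI ballI funcsetI)
  interpret F: left_module R "free_module R I"
    by (rule left_module_free_module) (rule R.ring_axioms)
  have supp: "finite {i. c i \<noteq> \<zero>\<^bsub>R\<^esub>}" "{i. c i \<noteq> \<zero>\<^bsub>R\<^esub>} \<subseteq> I"
    "\<And>i. i \<in> I \<Longrightarrow> c i \<in> carrier R"
    if "c \<in> carrier (free_module R I)" for c
    using that by (auto simp: free_module_def)
  {
    fix c assume c: "c \<in> carrier (free_module R I)"
    show "free_lift R M \<phi> c \<in> carrier M"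
      unfolding free_lift_def using supp[OF c] \<phi> by (intro M.finsum_closed) auto
  }
  {
    fix c d assume c: "c \<in> carrier (free_module R I)" and d: "d \<in> carrier (free_module R I)"
    let ?S = "{i. c i \<noteq> \<zero>\<^bsub>R\<^esub>} \<union> {i. d i \<noteq> \<zero>\<^bsub>R\<^esub>}"
    have S: "finite ?S" "?S \<subseteq> I" using supp[OF c] supp[OF d] by auto
    have car: "c i \<odot>\<^bsub>M\<^esub> \<phi> i \<in> carrier M" "d i \<odot>\<^bsub>M\<^esub> \<phi> i \<in> carrier M"
      and distr: "(c i \<oplus>\<^bsub>R\<^esub> d i) \<odot>\<^bsub>M\<^esub> \<phi> i = c i \<odot>\<^bsub>M\<^esub> \<phi> i \<oplus>\<^bsub>M\<^esub> d i \<odot>\<^bsub>M\<^esub> \<phi> i" if "i \<in> ?S" for i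
      using that S(2) supp(3)[OF c, of i] supp(3)[OF d, of i] \<phi>
      by (auto simp: Pi_iff subset_iff lsmult_l_distr)
    have "{i. (c \<oplus>\<^bsub>free_module R I\<^esub> d) i \<noteq> \<zero>\<^bsub>R\<^esub>} \<subseteq> ?S"
      by (auto simp: free_module_def)
    then have "free_lift R M \<phi> (c \<oplus>\<^bsub>free_module R I\<^esub> d) =
        finsum M (\<lambda>i. (c \<oplus>\<^bsub>free_module R I\<^esub> d) i \<odot>\<^bsub>M\<^esub> \<phi> i) ?S"
      using S by (intro free_lift_eq[OF F.M.a_closed[OF c d] \<phi>]) auto
    also have "\<dots> = finsum M (\<lambda>i. c i \<odot>\<^bsub>M\<^esub> \<phi> i \<oplus>\<^bsub>M\<^esub> d i \<odot>\<^bsub>M\<^esub> \<phi> i) ?S"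
      using car distr by (intro M.finsum_cong') (auto simp: free_module_def)
    also have "\<dots> = finsum M (\<lambda>i. c i \<odot>\<^bsub>M\<^esub> \<phi> i) ?S \<oplus>\<^bsub>M\<^esub> finsum M (\<lambda>i. d i \<odot>\<^bsub>M\<^esub> \<phi> i) ?S"
      using car by (intro M.finsum_addf) auto
    also have "finsum M (\<lambda>i. c i \<odot>\<^bsub>M\<^esub> \<phi> i) ?S = free_lift R M \<phi> c"
      using S by (intro free_lift_eq[OF c \<phi>, symmetric]) auto
    also have "finsum M (\<lambda>i. d i \<odot>\<^bsub>M\<^esub> \<phi> i) ?S = free_lift R M \<phi> d"
      using S by (intro free_lift_eq[OF d \<phi>, symmetric]) auto
    finally show "free_lift R M \<phi> (c \<oplus>\<^bsub>free_module R I\<^esub> d) =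
        free_lift R M \<phi> c \<oplus>\<^bsub>M\<^esub> free_lift R M \<phi> d" .
  }
  {
    fix a c assume a: "a \<in> carrier R" and c: "c \<in> carrier (free_module R I)"
    let ?S = "{i. c i \<noteq> \<zero>\<^bsub>R\<^esub>}"
    have car: "c i \<odot>\<^bsub>M\<^esub> \<phi> i \<in> carrier M" "a \<odot>\<^bsub>M\<^esub> (c i \<odot>\<^bsub>M\<^esub> \<phi> i) \<in> carrier M"
      and assoc: "(a \<otimes>\<^bsub>R\<^esub> c i) \<odot>\<^bsub>M\<^esub> \<phi> i = a \<odot>\<^bsub>M\<^esub> (c i \<odot>\<^bsub>M\<^esub> \<phi> i)" if "i \<in> ?S" for i
      using that supp[OF c] a \<phi> by (auto simp: Pi_iff subset_iff lsmult_assoc)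
    have "{i. (a \<odot>\<^bsub>free_module R I\<^esub> c) i \<noteq> \<zero>\<^bsub>R\<^esub>} \<subseteq> ?S"
      using a by (auto simp: free_module_def)
    then have "free_lift R M \<phi> (a \<odot>\<^bsub>free_module R I\<^esub> c) =
        finsum M (\<lambda>i. (a \<odot>\<^bsub>free_module R I\<^esub> c) i \<odot>\<^bsub>M\<^esub> \<phi> i) ?S"
      using supp[OF c] by (intro free_lift_eq[OF F.lsmult_closed[OF a c] \<phi>]) auto
    also have "\<dots> = finsum M (\<lambda>i. a \<odot>\<^bsub>M\<^esub> (c i \<odot>\<^bsub>M\<^esub> \<phi> i)) ?S"
      using car assoc by (intro M.finsum_cong') (auto simp: free_module_def)
    also have "\<dots> = a \<odot>\<^bsub>M\<^esub> free_lift R M \<phi> c"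
      unfolding free_lift_def using supp[OF c] a car by (intro lsmult_finsum[symmetric]) auto
    finally show "free_lift R M \<phi> (a \<odot>\<^bsub>free_module R I\<^esub> c) = a \<odot>\<^bsub>M\<^esub> free_lift R M \<phi> c" .
  }
qed

lemma free_lift_delta:
  assumes \<phi>: "\<phi> \<in> I \<rightarrow> carrier M" and i: "i \<in> I"
  shows "free_lift R M \<phi> (free_delta R i) = \<phi> i"
proof -
  have "free_lift R M \<phi> (free_delta R i) = finsum M (\<lambda>j. free_delta R i j \<odot>\<^bsub>M\<^esub> \<phi> j) {i}"
    using i by (intro free_lift_eq[OF free_delta_closed[OF R.ring_axioms i] \<phi>])
      (auto simp: free_delta_def)
  also have "\<dots> = \<phi> i"
    using \<phi> i by (simp add: M.finsum_insert free_delta_def Pi_iff)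
  finally show ?thesis .
qed

end

theorem projective_lifts_along:
  assumes P: "projective_module R P" and M: "left_module R M" and N: "left_module R N"
  shows "lifts_along R P M N"
  unfolding lifts_along_def
proof (intro ballI impI)
  fix g f assume g: "g \<in> left_module_hom R M N" and f: "f \<in> left_module_hom R P N"
    and surj: "g ` carrier M = carrier N"
  have P': "left_module R P" using P by (simp add: projective_module_def)
  interpret P: left_module R P by fact
  interpret M: left_module R M by fact
  interpret N: left_module R N by fact
  let ?F = "free_module R (carrier P)"
  have F: "left_module R ?F" by (rule left_module_free_module) (rule P.R.ring_axioms)
  have \<epsilon>: "free_lift R P id \<in> left_module_hom R ?F P"
    by (rule P.free_lift_hom) auto
  have "free_lift R P id ` carrier ?F = carrier P"
  proof
    show "free_lift R P id ` carrier ?F \<subseteq> carrier P"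
      using \<epsilon> by (auto simp: left_module_hom_def)
    show "carrier P \<subseteq> free_lift R P id ` carrier ?F"
    proof
      fix x assume x: "x \<in> carrier P"
      have "x = free_lift R P id (free_delta R x)"
        using P.free_lift_delta[of id "carrier P" x] x by simp
      then show "x \<in> free_lift R P id ` carrier ?F"
        using free_delta_closed[OF P.R.ring_axioms x] by blast
    qed
  qed
  moreover have "id \<in> left_module_hom R P P" by (auto simp: left_module_hom_def)
  moreover have "lifts_along R P ?F P" using P F P' by (simp add: projective_module_def)
  ultimately obtain s where s: "s \<in> left_module_hom R P ?F"
    and \<epsilon>s: "\<And>x. x \<in> carrier P \<Longrightarrow> free_lift R P id (s x) = x"
    using \<epsilon> by (force simp: lifts_along_def)
  have f_closed: "f x \<in> carrier N" if "x \<in> carrier P" for x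
    using f that by (auto simp: left_module_hom_def)
  define \<phi> where "\<phi> x = (SOME m. m \<in> carrier M \<and> g m = f x)" for x
  have "\<exists>m. m \<in> carrier M \<and> g m = f x" if "x \<in> carrier P" for x
    using f_closed[OF that] surj by (metis imageE)
  then have \<phi>: "\<phi> x \<in> carrier M" "g (\<phi> x) = f x" if "x \<in> carrier P" for x
    using that someI_ex[of "\<lambda>m. m \<in> carrier M \<and> g m = f x"] by (auto simp: \<phi>_def)
  have \<phi>_hom: "free_lift R M \<phi> \<in> left_module_hom R ?F M"
    by (rule M.free_lift_hom) (use \<phi> in auto)
  have eq: "g (free_lift R M \<phi> c) = f (free_lift R P id c)" if c: "c \<in> carrier ?F" for c
  proof -
    let ?S = "{i. c i \<noteq> \<zero>\<^bsub>R\<^esub>}"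
    have S: "finite ?S" "?S \<subseteq> carrier P" "\<And>i. i \<in> ?S \<Longrightarrow> c i \<in> carrier R"
      using c by (auto simp: free_module_def)
    have "g (free_lift R M \<phi> c) = finsum N (\<lambda>i. g (c i \<odot>\<^bsub>M\<^esub> \<phi> i)) ?S"
      unfolding free_lift_def
      by (rule left_module_hom_finsum[OF M N g]) (use S \<phi> in auto)
    also have "\<dots> = finsum N (\<lambda>i. f (c i \<odot>\<^bsub>P\<^esub> i)) ?S"
      using S f g \<phi> f_closed by (intro N.finsum_cong') (auto simp: left_module_hom_def subset_iff)
    also have "\<dots> = f (free_lift R P id c)"
      unfolding free_lift_def
      by (subst left_module_hom_finsum[OF P' N f]) (use S in auto)
    finally show ?thesis .
  qed
  show "\<exists>h\<in>left_module_hom R P M. \<forall>x\<in>carrier P. g (h x) = f x"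
  proof
    show "free_lift R M \<phi> \<circ> s \<in> left_module_hom R P M"
      using s \<phi>_hom by (auto simp: left_module_hom_def Pi_iff)
    show "\<forall>x\<in>carrier P. g ((free_lift R M \<phi> \<circ> s) x) = f x"
      using s \<epsilon>s eq by (auto simp: left_module_hom_def Pi_iff)
  qed
qed


section \<open>Tensor products over a commutative ring\<close>

inductive_set tensor_relations ::
    "('k, 's) ring_scheme \<Rightarrow> ('k, 'm, 't) module_scheme \<Rightarrow> ('k, 'n, 'u) module_scheme \<Rightarrow>
     ('m \<times> 'n \<Rightarrow> 'k) set"
  for K and M and N
  where
    add_left: "\<lbrakk>x \<in> carrier M; x' \<in> carrier M; y \<in> carrier N\<rbrakk> \<Longrightarrow>
      free_delta K (x \<oplus>\<^bsub>M\<^esub> x', y)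
        \<ominus>\<^bsub>free_module K (carrier M \<times> carrier N)\<^esub>
        (free_delta K (x, y) \<oplus>\<^bsub>free_module K (carrier M \<times> carrier N)\<^esub> free_delta K (x', y))
      \<in> tensor_relations K M N"
  | add_right: "\<lbrakk>x \<in> carrier M; y \<in> carrier N; y' \<in> carrier N\<rbrakk> \<Longrightarrow>
      free_delta K (x, y \<oplus>\<^bsub>N\<^esub> y')
        \<ominus>\<^bsub>free_module K (carrier M \<times> carrier N)\<^esub>
        (free_delta K (x, y) \<oplus>\<^bsub>free_module K (carrier M \<times> carrier N)\<^esub> free_delta K (x, y'))
      \<in> tensor_relations K M N"
  | smult_left: "\<lbrakk>k \<in> carrier K; x \<in> carrier M; y \<in> carrier N\<rbrakk> \<Longrightarrow>
      free_delta K (k \<odot>\<^bsub>M\<^esub> x, y)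
        \<ominus>\<^bsub>free_module K (carrier M \<times> carrier N)\<^esub>
        (k \<odot>\<^bsub>free_module K (carrier M \<times> carrier N)\<^esub> free_delta K (x, y))
      \<in> tensor_relations K M N"
  | smult_right: "\<lbrakk>k \<in> carrier K; x \<in> carrier M; y \<in> carrier N\<rbrakk> \<Longrightarrow>
      free_delta K (x, k \<odot>\<^bsub>N\<^esub> y)
        \<ominus>\<^bsub>free_module K (carrier M \<times> carrier N)\<^esub>
        (k \<odot>\<^bsub>free_module K (carrier M \<times> carrier N)\<^esub> free_delta K (x, y))
      \<in> tensor_relations K M N"

definition tensor_kernel ::
    "('k, 's) ring_scheme \<Rightarrow> ('k, 'm, 't) module_scheme \<Rightarrow> ('k, 'n, 'u) module_scheme \<Rightarrow>
     ('m \<times> 'n \<Rightarrow> 'k) set"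
  where "tensor_kernel K M N =
    (\<lambda>H. submodule H K (free_module K (carrier M \<times> carrier N))) hull tensor_relations K M N"

text \<open>
  The tensor product \<open>M \<otimes>\<^sub>K N\<close>, as the quotient group of the free module on \<open>M \<times> N\<close> by the
  submodule generated by the bilinearity relations; the induced action of \<open>K\<close> is not needed.
\<close>

definition tensor_product ::
    "('k, 's) ring_scheme \<Rightarrow> ('k, 'm, 't) module_scheme \<Rightarrow> ('k, 'n, 'u) module_scheme \<Rightarrow>
     ('m \<times> 'n \<Rightarrow> 'k) set monoid"
  where "tensor_product K M N =
    free_module K (carrier M \<times> carrier N) A_Mod tensor_kernel K M N"

definition pure_tensor ::
    "('k, 's) ring_scheme \<Rightarrow> ('k, 'm, 't) module_scheme \<Rightarrow> ('k, 'n, 'u) module_scheme \<Rightarrow>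
     'm \<Rightarrow> 'n \<Rightarrow> ('m \<times> 'n \<Rightarrow> 'k) set"
  where "pure_tensor K M N x y =
    tensor_kernel K M N +>\<^bsub>free_module K (carrier M \<times> carrier N)\<^esub> free_delta K (x, y)"

text \<open>
  The map \<open>P \<otimes>\<^sub>K P \<rightarrow> P\<close> induced by the multiplication of an algebra \<open>P\<close>: a class of the
  quotient is sent to the common value of its representatives. That there is one is the content
  of \<open>mult_map_coset\<close> below.
\<close>

definition mult_map ::
    "('k, 's) ring_scheme \<Rightarrow> ('k, 'p, 't) module_scheme \<Rightarrow> ('p \<times> 'p \<Rightarrow> 'k) set \<Rightarrow> 'p"
  where "mult_map K P t = the_elem (free_lift K P (\<lambda>(x, y). x \<otimes>\<^bsub>P\<^esub> y) ` t)"


section \<open>Homotopes and well-tempered elements\<close>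

text \<open>
  The homotope is in general not unital; the field \<^const>\<open>one\<close> inherited from \<open>A\<close> is
  meaningless in it and is never used.
\<close>

definition homotope :: "('k, 'a, 't) module_scheme \<Rightarrow> 'a \<Rightarrow> ('k, 'a, 't) module_scheme"
  where "homotope A \<Delta> = A\<lparr>mult := \<lambda>a b. a \<otimes>\<^bsub>A\<^esub> \<Delta> \<otimes>\<^bsub>A\<^esub> b\<rparr>"

text \<open>The pair \<open>(k, x)\<close> stands for \<open>k\<cdot>1 + x\<close>.\<close>

definition unitization ::
    "('k, 's) ring_scheme \<Rightarrow> ('k, 'p, 't) module_scheme \<Rightarrow> ('k \<times> 'p) ring"
  where "unitization K P =
    \<lparr>carrier = carrier K \<times> carrier P,
     mult = (\<lambda>(k, x) (l, y). (k \<otimes>\<^bsub>K\<^esub> l, k \<odot>\<^bsub>P\<^esub> y \<oplus>\<^bsub>P\<^esub> l \<odot>\<^bsub>P\<^esub> x \<oplus>\<^bsub>P\<^esub> x \<otimes>\<^bsub>P\<^esub> y)),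
     one = (\<one>\<^bsub>K\<^esub>, \<zero>\<^bsub>P\<^esub>),
     zero = (\<zero>\<^bsub>K\<^esub>, \<zero>\<^bsub>P\<^esub>),
     add = (\<lambda>(k, x) (l, y). (k \<oplus>\<^bsub>K\<^esub> l, x \<oplus>\<^bsub>P\<^esub> y))\<rparr>"

definition augmentation_ideal ::
    "('k, 's) ring_scheme \<Rightarrow> ('k, 'p, 't) module_scheme \<Rightarrow> ('k \<times> 'p) set"
  where "augmentation_ideal K P = {\<zero>\<^bsub>K\<^esub>} \<times> carrier P"

definition ideal_module :: "('r, 's) ring_scheme \<Rightarrow> 'r set \<Rightarrow> ('r, 'r) module"
  where "ideal_module R I =
    \<lparr>carrier = I, mult = mult R, one = one R, zero = zero R, add = add R, smult = mult R\<rparr>"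

definition well_tempered ::
    "('k, 's) ring_scheme \<Rightarrow> ('k, 'a, 't) module_scheme \<Rightarrow> 'a \<Rightarrow> bool"
  where "well_tempered K A \<Delta> \<longleftrightarrow>
    (let P = homotope A \<Delta>; B = unitization K P; I = augmentation_ideal K P in
       mult_map K P ` carrier (tensor_product K P P) = carrier P \<and>
       projective_module B (ideal_module B I) \<and>
       projective_module (opposite_ring B) (ideal_module (opposite_ring B) I))"


subsection \<open>Basic properties\<close>

locale nonunital_algebra = module K P for K and P (structure) +
  assumes mult_closed [simp, intro]:
      "\<lbrakk>x \<in> carrier P; y \<in> carrier P\<rbrakk> \<Longrightarrow> x \<otimes>\<^bsub>P\<^esub> y \<in> carrier P"
    and mult_assoc:
      "\<lbrakk>x \<in> carrier P; y \<in> carrier P; z \<in> carrier P\<rbrakk> \<Longrightarrow> (x \<otimes>\<^bsub>P\<^esub> y) \<otimes>\<^bsub>P\<^esub> z = x \<otimes>\<^bsub>P\<^esub> (y \<otimes>\<^bsub>P\<^esub> z)"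
    and mult_l_distr:
      "\<lbrakk>x \<in> carrier P; y \<in> carrier P; z \<in> carrier P\<rbrakk> \<Longrightarrow>
        (x \<oplus>\<^bsub>P\<^esub> y) \<otimes>\<^bsub>P\<^esub> z = x \<otimes>\<^bsub>P\<^esub> z \<oplus>\<^bsub>P\<^esub> y \<otimes>\<^bsub>P\<^esub> z"
    and mult_r_distr:
      "\<lbrakk>x \<in> carrier P; y \<in> carrier P; z \<in> carrier P\<rbrakk> \<Longrightarrow>
        x \<otimes>\<^bsub>P\<^esub> (y \<oplus>\<^bsub>P\<^esub> z) = x \<otimes>\<^bsub>P\<^esub> y \<oplus>\<^bsub>P\<^esub> x \<otimes>\<^bsub>P\<^esub> z"
    and smult_mult_left:
      "\<lbrakk>k \<in> carrier K; x \<in> carrier P; y \<in> carrier P\<rbrakk> \<Longrightarrow> (k \<odot>\<^bsub>P\<^esub> x) \<otimes>\<^bsub>P\<^esub> y = k \<odot>\<^bsub>P\<^esub> (x \<otimes>\<^bsub>P\<^esub> y)"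
    and smult_mult_right:
      "\<lbrakk>k \<in> carrier K; x \<in> carrier P; y \<in> carrier P\<rbrakk> \<Longrightarrow> x \<otimes>\<^bsub>P\<^esub> (k \<odot>\<^bsub>P\<^esub> y) = k \<odot>\<^bsub>P\<^esub> (x \<otimes>\<^bsub>P\<^esub> y)"

lemma (in algebra) nonunital_algebra: "nonunital_algebra R M"
proof (intro nonunital_algebra.intro nonunital_algebra_axioms.intro module)
  show "x \<otimes>\<^bsub>M\<^esub> (k \<odot>\<^bsub>M\<^esub> y) = k \<odot>\<^bsub>M\<^esub> (x \<otimes>\<^bsub>M\<^esub> y)"
    if "k \<in> carrier R" "x \<in> carrier M" "y \<in> carrier M" for k x y
    using smult_assoc2[of k y x] that by (simp add: m_comm)
qed (auto simp: m_assoc l_distr r_distr smult_assoc2)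

lemma nonunital_algebra_homotope:
  assumes "nonunital_algebra K A" "\<Delta> \<in> carrier A"
  shows "nonunital_algebra K (homotope A \<Delta>)"
proof -
  interpret nonunital_algebra K A by fact
  have "abelian_group (homotope A \<Delta>)"
  proof (rule abelian_groupI)
    show "\<exists>y\<in>carrier (homotope A \<Delta>). y \<oplus>\<^bsub>homotope A \<Delta>\<^esub> x = \<zero>\<^bsub>homotope A \<Delta>\<^esub>"
      if "x \<in> carrier (homotope A \<Delta>)" for x
      using that by (intro bexI[of _ "\<ominus>\<^bsub>A\<^esub> x"]) (auto simp: homotope_def M.l_neg)
  qed (auto simp: homotope_def M.a_ac)
  then have "module K (homotope A \<Delta>)"
    by (intro moduleI is_cring)
       (auto simp: homotope_def smult_l_distr smult_r_distr smult_assoc1)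
  then show ?thesis
    using assms(2)
    by (intro nonunital_algebra.intro nonunital_algebra_axioms.intro)
       (auto simp: homotope_def mult_assoc mult_l_distr mult_r_distr smult_mult_left
          smult_mult_right)
qed


context nonunital_algebra begin

lemma mult_l_null [simp]: "x \<in> carrier P \<Longrightarrow> \<zero>\<^bsub>P\<^esub> \<otimes>\<^bsub>P\<^esub> x = \<zero>\<^bsub>P\<^esub>"
  using mult_l_distr[of "\<zero>\<^bsub>P\<^esub>" "\<zero>\<^bsub>P\<^esub>" x] by (simp add: M.add.r_cancel_one')

lemma mult_r_null [simp]: "x \<in> carrier P \<Longrightarrow> x \<otimes>\<^bsub>P\<^esub> \<zero>\<^bsub>P\<^esub> = \<zero>\<^bsub>P\<^esub>"
  using mult_r_distr[of x "\<zero>\<^bsub>P\<^esub>" "\<zero>\<^bsub>P\<^esub>"] by (simp add: M.add.r_cancel_one')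

lemma ring_unitization: "ring (unitization K P)"
proof (rule ringI)
  show "abelian_group (unitization K P)"
  proof (rule abelian_groupI)
    show "\<exists>y\<in>carrier (unitization K P). y \<oplus>\<^bsub>unitization K P\<^esub> x = \<zero>\<^bsub>unitization K P\<^esub>"
      if "x \<in> carrier (unitization K P)" for x
      using that
      by (intro bexI[of _ "(\<ominus>\<^bsub>K\<^esub> fst x, \<ominus>\<^bsub>P\<^esub> snd x)"])
         (auto simp: unitization_def R.l_neg M.l_neg)
  qed (auto simp: unitization_def R.a_ac M.a_ac)
  show "monoid (unitization K P)"
    by (rule monoidI)
       (auto simp: unitization_def R.m_ac M.a_ac smult_r_distr smult_assoc1[symmetric]
          smult_l_distr mult_assoc mult_l_distr mult_r_distr smult_mult_left smult_mult_right)
qed (auto simp: unitization_def R.l_distr R.r_distr smult_l_distr smult_r_distr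
      mult_l_distr mult_r_distr M.a_ac)

lemma ideal_augmentation_ideal: "ideal (augmentation_ideal K P) (unitization K P)"
proof (rule idealI[OF ring_unitization])
  interpret B: ring "unitization K P" by (rule ring_unitization)
  show "subgroup (augmentation_ideal K P) (add_monoid (unitization K P))"
  proof (rule B.add.subgroupI)
    show "\<ominus>\<^bsub>unitization K P\<^esub> x \<in> augmentation_ideal K P" if "x \<in> augmentation_ideal K P" for x
    proof -
      have "\<ominus>\<^bsub>unitization K P\<^esub> x = (\<zero>\<^bsub>K\<^esub>, \<ominus>\<^bsub>P\<^esub> snd x)"
        using that
        by (intro B.minus_equality)
           (auto simp: augmentation_ideal_def unitization_def M.l_neg)
      then show ?thesis using that by (auto simp: augmentation_ideal_def)
    qed
  qed (auto simp: augmentation_ideal_def unitization_def)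
qed (auto simp: augmentation_ideal_def unitization_def)

lemma mult_free_lift_hom:
  "free_lift K P (\<lambda>(x, y). x \<otimes>\<^bsub>P\<^esub> y)
     \<in> left_module_hom K (free_module K (carrier P \<times> carrier P)) P"
  by (rule left_module.free_lift_hom[OF left_module]) auto

lemma submodule_tensor_kernel:
  "submodule (tensor_kernel K P P) K (free_module K (carrier P \<times> carrier P))"
proof -
  interpret F: module K "free_module K (carrier P \<times> carrier P)"
    by (rule module_free_module) (rule R.is_cring)
  have sub: "tensor_relations K P P \<subseteq> carrier (free_module K (carrier P \<times> carrier P))"
  proof
    fix r assume "r \<in> tensor_relations K P P"
    then show "r \<in> carrier (free_module K (carrier P \<times> carrier P))"
      by cases (auto intro!: F.M.minus_closed F.M.a_closed F.smult_closed free_delta_closed R.ring_axioms)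
  qed
  let ?S = "{H. submodule H K (free_module K (carrier P \<times> carrier P)) \<and> tensor_relations K P P \<subseteq> H}"
  have ne: "carrier (free_module K (carrier P \<times> carrier P)) \<in> ?S"
    using F.carrier_is_submodule sub by auto
  have S: "submodule H K (free_module K (carrier P \<times> carrier P))" if "H \<in> ?S" for H
    using that by auto
  have "submodule (\<Inter>?S) K (free_module K (carrier P \<times> carrier P))"
  proof (rule F.submoduleI)
    show "\<Inter>?S \<subseteq> carrier (free_module K (carrier P \<times> carrier P))" using ne by blast
    show "\<zero>\<^bsub>free_module K (carrier P \<times> carrier P)\<^esub> \<in> \<Inter>?S"
      using subgroup.one_closed[OF submodule.axioms(1)[OF S]] by auto
    show "\<ominus>\<^bsub>free_module K (carrier P \<times> carrier P)\<^esub> a \<in> \<Inter>?S" if "a \<in> \<Inter>?S" for a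
      using F.submoduleE(3)[OF S] that by blast
    show "a \<oplus>\<^bsub>free_module K (carrier P \<times> carrier P)\<^esub> b \<in> \<Inter>?S" if "a \<in> \<Inter>?S" "b \<in> \<Inter>?S" for a b
      using F.submoduleE(5)[OF S] that by blast
    show "k \<odot>\<^bsub>free_module K (carrier P \<times> carrier P)\<^esub> a \<in> \<Inter>?S"
      if "k \<in> carrier K" "a \<in> \<Inter>?S" for k a
      using F.submoduleE(4)[OF S] that by blast
  qed
  then show ?thesis by (simp add: tensor_kernel_def hull_def)
qed

lemma mult_free_lift_tensor_kernel:
  assumes "c \<in> tensor_kernel K P P"
  shows "free_lift K P (\<lambda>(x, y). x \<otimes>\<^bsub>P\<^esub> y) c = \<zero>\<^bsub>P\<^esub>"
proof -
  define F where "F = free_module K (carrier P \<times> carrier P)"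
  define \<mu> where "\<mu> = free_lift K P (\<lambda>(x, y). x \<otimes>\<^bsub>P\<^esub> y)"
  interpret F: module K F
    unfolding F_def by (rule module_free_module) (rule R.is_cring)
  have \<mu>: "\<mu> \<in> left_module_hom K F P"
    unfolding \<mu>_def F_def by (rule mult_free_lift_hom)
  have \<mu>_closed [simp]: "\<mu> a \<in> carrier P" if "a \<in> carrier F" for a
    using \<mu> that by (auto simp: left_module_hom_def)
  have \<mu>_add: "\<mu> (a \<oplus>\<^bsub>F\<^esub> b) = \<mu> a \<oplus>\<^bsub>P\<^esub> \<mu> b" if "a \<in> carrier F" "b \<in> carrier F" for a b
    using \<mu> that by (auto simp: left_module_hom_def)
  have \<mu>_smult: "\<mu> (k \<odot>\<^bsub>F\<^esub> a) = k \<odot>\<^bsub>P\<^esub> \<mu> a" if "k \<in> carrier K" "a \<in> carrier F" for k a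
    using \<mu> that by (auto simp: left_module_hom_def)
  have \<mu>_zero: "\<mu> \<zero>\<^bsub>F\<^esub> = \<zero>\<^bsub>P\<^esub>"
    by (rule left_module_hom_zero[OF F.left_module left_module \<mu>])
  have \<mu>_neg: "\<mu> (\<ominus>\<^bsub>F\<^esub> a) = \<ominus>\<^bsub>P\<^esub> \<mu> a" if "a \<in> carrier F" for a
    using \<mu>_add[of "\<ominus>\<^bsub>F\<^esub> a" a] that
    by (intro M.minus_equality[symmetric]) (auto simp: F.M.l_neg \<mu>_zero)
  have \<mu>_minus: "\<mu> (a \<ominus>\<^bsub>F\<^esub> b) = \<mu> a \<ominus>\<^bsub>P\<^esub> \<mu> b" if "a \<in> carrier F" "b \<in> carrier F" for a b
    using that by (simp add: a_minus_def \<mu>_add \<mu>_neg)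
  have \<delta>_closed [simp]: "free_delta K (x, y) \<in> carrier F" if "x \<in> carrier P" "y \<in> carrier P" for x y
    using that by (auto simp: F_def intro!: free_delta_closed R.ring_axioms)
  have \<mu>_\<delta> [simp]: "\<mu> (free_delta K (x, y)) = x \<otimes>\<^bsub>P\<^esub> y" if "x \<in> carrier P" "y \<in> carrier P" for x y
    unfolding \<mu>_def
    by (subst left_module.free_lift_delta[OF left_module, of _ "carrier P \<times> carrier P"])
       (use that in auto)
  let ?H = "{a \<in> carrier F. \<mu> a = \<zero>\<^bsub>P\<^esub>}"
  have "submodule ?H K F"
    by (rule F.submoduleI) (auto simp: \<mu>_zero \<mu>_neg \<mu>_add \<mu>_smult)
  moreover have "tensor_relations K P P \<subseteq> ?H"
  proof
    fix r assume "r \<in> tensor_relations K P P"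
    then show "r \<in> ?H"
      by (cases, fold F_def)
         (auto simp: \<mu>_minus \<mu>_add \<mu>_smult mult_l_distr mult_r_distr smult_mult_left
            smult_mult_right M.r_neg a_minus_def[of P] intro!: F.M.minus_closed)
  qed
  ultimately have "tensor_kernel K P P \<subseteq> ?H"
    unfolding tensor_kernel_def F_def[symmetric] by (intro hull_minimal)
  then show ?thesis using assms by (auto simp: \<mu>_def)
qed

theorem mult_map_coset:
  assumes c: "c \<in> carrier (free_module K (carrier P \<times> carrier P))"
  shows "mult_map K P (tensor_kernel K P P +>\<^bsub>free_module K (carrier P \<times> carrier P)\<^esub> c) =
    free_lift K P (\<lambda>(x, y). x \<otimes>\<^bsub>P\<^esub> y) c"
proof -
  let ?F = "free_module K (carrier P \<times> carrier P)"
  let ?\<mu> = "free_lift K P (\<lambda>(x, y). x \<otimes>\<^bsub>P\<^esub> y)"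
  interpret F: module K ?F by (rule module_free_module) (rule R.is_cring)
  note N = submodule_tensor_kernel
  have eq: "?\<mu> (d \<oplus>\<^bsub>?F\<^esub> c) = ?\<mu> c" if d: "d \<in> tensor_kernel K P P" for d
    using mult_free_lift_hom c F.submoduleE(1)[OF N] d mult_free_lift_tensor_kernel[OF d]
    by (auto simp: left_module_hom_def Pi_iff subset_iff)
  have "\<zero>\<^bsub>?F\<^esub> \<in> tensor_kernel K P P"
    using subgroup.one_closed[OF submodule.axioms(1)[OF N]] by simp
  then have "?\<mu> ` (tensor_kernel K P P +>\<^bsub>?F\<^esub> c) = {?\<mu> c}"
    using eq by (auto simp: a_r_coset_def' image_iff intro!: bexI[of _ "\<zero>\<^bsub>?F\<^esub>"])
  then show ?thesis by (simp add: mult_map_def)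
qed

corollary mult_map_pure_tensor:
  assumes "x \<in> carrier P" "y \<in> carrier P"
  shows "mult_map K P (pure_tensor K P P x y) = x \<otimes>\<^bsub>P\<^esub> y"
proof -
  have "mult_map K P (pure_tensor K P P x y) =
      free_lift K P (\<lambda>(x, y). x \<otimes>\<^bsub>P\<^esub> y) (free_delta K (x, y))"
    unfolding pure_tensor_def
    by (rule mult_map_coset) (use assms in \<open>auto intro!: free_delta_closed R.ring_axioms\<close>)
  also have "\<dots> = (case (x, y) of (x, y) \<Rightarrow> x \<otimes>\<^bsub>P\<^esub> y)"
    by (rule left_module.free_lift_delta[OF left_module, of _ "carrier P \<times> carrier P"])
       (use assms in auto)
  finally show ?thesis by simp
qed

end

lemma left_module_ideal_module:
  assumes "ideal I R"
  shows "left_module R (ideal_module R I)"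
proof -
  interpret ideal I R by fact
  have [simp]: "x \<in> carrier R" if "x \<in> I" for x using that by (rule a_Hcarr)
  show ?thesis
  proof (rule left_moduleI[OF ring_axioms])
    show "abelian_group (ideal_module R I)"
    proof (rule abelian_groupI)
      show "\<exists>y\<in>carrier (ideal_module R I). y \<oplus>\<^bsub>ideal_module R I\<^esub> x = \<zero>\<^bsub>ideal_module R I\<^esub>"
        if "x \<in> carrier (ideal_module R I)" for x
        using that by (intro bexI[of _ "\<ominus>\<^bsub>R\<^esub> x"]) (auto simp: ideal_module_def l_neg)
    qed (auto simp: ideal_module_def a_ac)
  qed (auto simp: ideal_module_def l_distr r_distr m_assoc I_l_closed)
qed

lemma ideal_opposite_ring:
  assumes "ideal I R"
  shows "ideal I (opposite_ring R)"
proof -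
  interpret ideal I R by fact
  have "add_monoid (opposite_ring R) = add_monoid R" by (simp add: opposite_ring_def)
  then show ?thesis
    using a_subgroup ring_opposite_ring[OF ring_axioms]
    by (intro idealI) (auto simp: opposite_ring_def I_l_closed I_r_closed)
qed

end

theory Submission
  imports Defs
begin

lemma carrier_tensor_product:
  "carrier (tensor_product K M N) =
    (\<lambda>c. tensor_kernel K M N +>\<^bsub>free_module K (carrier M \<times> carrier N)\<^esub> c) `
      carrier (free_module K (carrier M \<times> carrier N))"
  by (auto simp: tensor_product_def A_FactGroup_def FactGroup_def RCOSETS_def a_r_coset_def)

text \<open>Every class is the coset of some formal combination, on which
  \<open>mult_map_coset\<close> evaluates \<open>mult_map\<close>. Surjectivity of multiplication
  thus becomes a statement about finite sums of scaled products, with no quotient left.\<close>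

lemma (in nonunital_algebra) mult_map_image:
  "mult_map K P ` carrier (tensor_product K P P) =
    free_lift K P (\<lambda>(x, y). x \<otimes>\<^bsub>P\<^esub> y) ` carrier (free_module K (carrier P \<times> carrier P))"
  by (simp add: carrier_tensor_product image_image mult_map_coset cong: image_cong)

text \<open>If \<open>R \<rightarrow> I\<close>, \<open>x \<mapsto> x e\<close> splits the inclusion, a homomorphism on \<open>I\<close> is
  determined by the image of \<open>e\<close>, and choosing a preimage of that image lifts it.\<close>

lemma projective_ideal_module:
  assumes I: "ideal I R" and e: "e \<in> I" and re: "\<And>x. x \<in> I \<Longrightarrow> x \<otimes>\<^bsub>R\<^esub> e = x"
  shows "projective_module R (ideal_module R I)"
  unfolding projective_module_def lifts_along_def
proof (intro conjI allI impI ballI)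
  show "left_module R (ideal_module R I)" by (rule left_module_ideal_module[OF I])
next
  fix M :: "('a, 'a \<Rightarrow> 'a) module" and N :: "('a, 'a) module" and g f
  assume M: "left_module R M" and g: "g \<in> left_module_hom R M N"
    and f: "f \<in> left_module_hom R (ideal_module R I) N" and surj: "g ` carrier M = carrier N"
  interpret ideal I R by fact
  interpret M: left_module R M by fact
  have [simp]: "x \<in> carrier R" if "x \<in> I" for x using that by (rule a_Hcarr)
  have "f e \<in> carrier N"
    using f e by (auto simp: left_module_hom_def ideal_module_def)
  then obtain m where m: "m \<in> carrier M" "g m = f e"
    using surj by (metis imageE)
  show "\<exists>h\<in>left_module_hom R (ideal_module R I) M.
      \<forall>x\<in>carrier (ideal_module R I). g (h x) = f x"
  proof
    show "(\<lambda>x. x \<odot>\<^bsub>M\<^esub> m) \<in> left_module_hom R (ideal_module R I) M"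
      using m by (auto simp: left_module_hom_def ideal_module_def M.lsmult_l_distr M.lsmult_assoc)
    show "\<forall>x\<in>carrier (ideal_module R I). g (x \<odot>\<^bsub>M\<^esub> m) = f x"
    proof
      fix x assume "x \<in> carrier (ideal_module R I)"
      then have x: "x \<in> I" by (simp add: ideal_module_def)
      have "g (x \<odot>\<^bsub>M\<^esub> m) = x \<odot>\<^bsub>N\<^esub> f e"
        using g m x by (auto simp: left_module_hom_def)
      \<comment> \<open>As \<open>e\<close> lies in \<open>I\<close>, the ring product of
        \<open>x\<close> and \<open>e\<close> is also the action of the scalar \<open>x\<close> on
        the module element \<open>e\<close>, so linearity of \<open>f\<close> applies.\<close>
      also have "\<dots> = f (x \<otimes>\<^bsub>R\<^esub> e)"
        using f x e by (auto simp: left_module_hom_def ideal_module_def)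
      finally show "g (x \<odot>\<^bsub>M\<^esub> m) = f x" by (simp add: re x)
    qed
  qed
qed

text \<open>Surjectivity writes 1 as a finite sum of terms k (x \<Delta> y). Commutativity pulls
  \<Delta> out of the sum, and the cofactor, the sum of the k (x y), is the inverse.\<close>

lemma (in algebra) homotope_mult_surj_imp_Units:
  assumes \<Delta>: "\<Delta> \<in> carrier M"
    and surj: "mult_map R (homotope M \<Delta>) ` carrier (tensor_product R (homotope M \<Delta>) (homotope M \<Delta>)) =
      carrier (homotope M \<Delta>)"
  shows "\<Delta> \<in> Units M"
proof -
  define P where "P = homotope M \<Delta>"
  interpret P: nonunital_algebra R P
    unfolding P_def by (rule nonunital_algebra_homotope[OF nonunital_algebra \<Delta>])
  have P [simp]: "carrier P = carrier M" "add P = add M" "smult P = smult M"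
    "x \<otimes>\<^bsub>P\<^esub> y = x \<otimes>\<^bsub>M\<^esub> \<Delta> \<otimes>\<^bsub>M\<^esub> y" for x y
    by (simp_all add: P_def homotope_def)
  let ?F = "free_module R (carrier M \<times> carrier M)"
  have "\<one>\<^bsub>M\<^esub> \<in> free_lift R P (\<lambda>(x, y). x \<otimes>\<^bsub>P\<^esub> y) `
      carrier (free_module R (carrier P \<times> carrier P))"
    unfolding P.mult_map_image[symmetric] using surj[folded P_def] by simp
  then obtain c where c: "c \<in> carrier ?F"
    and one: "\<one>\<^bsub>M\<^esub> = free_lift R P (\<lambda>(x, y). x \<otimes>\<^bsub>P\<^esub> y) c"
    unfolding P by (elim imageE)
  let ?S = "{i. c i \<noteq> \<zero>\<^bsub>R\<^esub>}" and ?r = "\<lambda>z. z \<otimes>\<^bsub>M\<^esub> \<Delta>"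
  have S: "finite ?S" "?S \<subseteq> carrier M \<times> carrier M" "\<And>i. i \<in> ?S \<Longrightarrow> c i \<in> carrier R"
    using c by (auto simp: free_module_def)
  \<comment> \<open>The candidate inverse: the formal combination \<open>c\<close> that represents 1
    in the homotope, evaluated with the original multiplication instead.\<close>
  define z where "z = free_lift R M (\<lambda>(x, y). x \<otimes>\<^bsub>M\<^esub> y) c"
  have "free_lift R M (\<lambda>(x, y). x \<otimes>\<^bsub>M\<^esub> y) \<in> left_module_hom R ?F M"
    by (rule left_module.free_lift_hom[OF left_module]) auto
  then have z: "z \<in> carrier M"
    using c by (auto simp: left_module_hom_def z_def)
  \<comment> \<open>By commutativity the multiplication \<open>x \<Delta> y = (x y) \<Delta>\<close> of the homotope
    factors through \<open>z \<mapsto> z \<Delta>\<close>.\<close>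
  have r: "?r \<in> left_module_hom R M P"
    using \<Delta> by (auto simp: left_module_hom_def l_distr smult_assoc2)
  \<comment> \<open>Taking \<open>P\<close> as the codomain of \<open>?r\<close> makes the resulting
    sum directly comparable with the expansion of \<open>one\<close>, which is a sum in
    \<open>P\<close>.\<close>
  have "z \<otimes>\<^bsub>M\<^esub> \<Delta> = finsum P (\<lambda>i. ?r (c i \<odot>\<^bsub>M\<^esub> (case i of (x, y) \<Rightarrow> x \<otimes>\<^bsub>M\<^esub> y))) ?S"
    unfolding z_def free_lift_def
    by (rule left_module_hom_finsum[OF left_module P.left_module r]) (use S in auto)
  also have "\<dots> = finsum P (\<lambda>i. c i \<odot>\<^bsub>P\<^esub> (case i of (x, y) \<Rightarrow> x \<otimes>\<^bsub>P\<^esub> y)) ?S"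
  proof (rule P.M.finsum_cong')
    show "?r (c i \<odot>\<^bsub>M\<^esub> (case i of (x, y) \<Rightarrow> x \<otimes>\<^bsub>M\<^esub> y)) =
        c i \<odot>\<^bsub>P\<^esub> (case i of (x, y) \<Rightarrow> x \<otimes>\<^bsub>P\<^esub> y)" if iS: "i \<in> ?S" for i
    proof -
      obtain x y where i: "i = (x, y)" "x \<in> carrier M" "y \<in> carrier M" "c i \<in> carrier R"
        using S(2,3) iS by blast
      then show ?thesis
        using \<Delta> by (simp add: m_ac nonunital_algebra.smult_mult_right[OF nonunital_algebra])
    qed
  qed (use S \<Delta> in auto)
  also have "\<dots> = \<one>\<^bsub>M\<^esub>"
    by (simp only: one free_lift_def)
  finally have "z \<otimes>\<^bsub>M\<^esub> \<Delta> = \<one>\<^bsub>M\<^esub>" .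
  then show ?thesis
    using z \<Delta> m_comm[OF z \<Delta>] unfolding Units_def by (auto intro!: bexI[of _ z])
qed

text \<open>The inverse \<open>e\<close> of \<Delta> is a two-sided unit of the homotope, since x
  \<Delta> e = x = e \<Delta> x. Hence x is the image of the pure tensor of x and \<open>e\<close>,
  and the pair (0, \<open>e\<close>) acts as an identity on the augmentation ideal from both sides,
  which makes the ideal projective on both sides.\<close>

lemma (in algebra) Units_imp_well_tempered:
  assumes \<Delta>: "\<Delta> \<in> Units M"
  shows "well_tempered R M \<Delta>"
proof -
  define P where "P = homotope M \<Delta>"
  define e where "e = inv\<^bsub>M\<^esub> \<Delta>"
  have \<Delta>c: "\<Delta> \<in> carrier M" and e: "e \<in> carrier M" "e \<otimes>\<^bsub>M\<^esub> \<Delta> = \<one>\<^bsub>M\<^esub>" "\<Delta> \<otimes>\<^bsub>M\<^esub> e = \<one>\<^bsub>M\<^esub>"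
    using \<Delta> by (auto simp: e_def)
  interpret P: nonunital_algebra R P
    unfolding P_def by (rule nonunital_algebra_homotope[OF nonunital_algebra \<Delta>c])
  have carP: "carrier M = carrier P"
    by (simp add: P_def homotope_def)
  have unit: "x \<otimes>\<^bsub>P\<^esub> e = x" "e \<otimes>\<^bsub>P\<^esub> x = x" if "x \<in> carrier P" for x
    using that[folded carP] \<Delta>c e by (auto simp: P_def homotope_def m_assoc)
  have eP: "e \<in> carrier P"
    using e carP by simp
  let ?B = "unitization R P" and ?I = "augmentation_ideal R P"
  have "mult_map R P ` carrier (tensor_product R P P) = carrier P"
  proof
    show "mult_map R P ` carrier (tensor_product R P P) \<subseteq> carrier P"
      unfolding P.mult_map_image
      using P.mult_free_lift_hom by (auto simp: left_module_hom_def)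
    show "carrier P \<subseteq> mult_map R P ` carrier (tensor_product R P P)"
    proof
      fix x assume x: "x \<in> carrier P"
      have "pure_tensor R P P x e \<in> carrier (tensor_product R P P)"
        unfolding carrier_tensor_product pure_tensor_def
        using x eP by (intro imageI free_delta_closed R.ring_axioms) auto
      moreover have "mult_map R P (pure_tensor R P P x e) = x"
        using x eP unit by (simp add: P.mult_map_pure_tensor)
      ultimately show "x \<in> mult_map R P ` carrier (tensor_product R P P)"
        by (metis imageI)
    qed
  qed
  moreover have e': "(\<zero>\<^bsub>R\<^esub>, e) \<in> ?I"
    using eP by (simp add: augmentation_ideal_def)
  \<comment> \<open>Between pairs with zero scalar part the product in \<open>?B\<close> reduces to
    the product of \<open>P\<close>, so the right unit law of \<open>e\<close> carries over.\<close>
  moreover have "projective_module ?B (ideal_module ?B ?I)"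
    by (rule projective_ideal_module[OF P.ideal_augmentation_ideal e'])
       (use eP unit in \<open>auto simp: augmentation_ideal_def unitization_def\<close>)
  \<comment> \<open>Multiplying by (0, \<open>e\<close>) on the right in the opposite ring is
    multiplying on the left in \<open>?B\<close>; here the left unit law enters.\<close>
  moreover have "projective_module (opposite_ring ?B) (ideal_module (opposite_ring ?B) ?I)"
    by (rule projective_ideal_module[OF ideal_opposite_ring[OF P.ideal_augmentation_ideal] e'])
       (use eP unit in \<open>auto simp: augmentation_ideal_def unitization_def opposite_ring_def\<close>)
  ultimately show ?thesis
    by (simp add: well_tempered_def Let_def P_def)
qed

theorem lemma19:
  fixes K :: "('k, 's) ring_scheme" and A :: "('k, 'a, 't) module_scheme" and \<Delta> :: 'a
  assumes "algebra K A"
    and "is_free_module K A"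
    and "\<Delta> \<in> carrier A"
  shows "well_tempered K A \<Delta> \<longleftrightarrow> \<Delta> \<in> Units A"
  using assms(3) algebra.homotope_mult_surj_imp_Units[OF assms(1)]
    algebra.Units_imp_well_tempered[OF assms(1)]
  by (auto simp: well_tempered_def Let_def)

end
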